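(* Let $f\colon[0,1)\to\mathbb{R}$ be a function and let $\epsilon\in(0,1)$, $a,b,r\in\mathbb{R}^+$ be constants such that $f$ is monotone increasing on $[0,\epsilon]$ and $a x^r\le f(x)\le b x^r$ for every $x\in[0,\epsilon]$. Let $m\ge 1$ and let $k_1\ge k_2\ge\dots\ge k_m>0$ be real numbers. Put $U_j=\sum_{i=j+1}^m k_i$ and $L_j=\sum_{i=1}^j k_i$ for $1\le j\le m$, and $$d_C=\sqrt[r]{\min_{1\le j\le m}\Big\{\frac{a k_j-bU_j}{a k_j+bL_j}\Big\}}.$$ If $d_C>0$ (i.e., the minimum under the root is positive), then for every $x$ with $0<x<\min\{\epsilon,d_C\}$ the achievement set $E\bigl(w_n(x)\bigr)$ is homeomorphic to the Cantor set.
   Context: The achievement set of a summable sequence $(z_n)_{n\ge1}$ of non-negative reals is $E(z_n)=\{\sum_{n=1}^\infty c_n z_n : c_n\in\{0,1\}\}$. Given $f$ and $k_1,\dots,k_m$ as in the claim, the generalized multigeometric sequence is $w_n(x)=k_{g(n)}\,f\bigl(x^{\lfloor (m+n-1)/m\rfloor}\bigr)$ for $n\ge1$, where $g(n)=1+((n-1)\bmod m)$; that is, the sequence $k_1f(x),\dots,k_mf(x),k_1f(x^2),\dots,k_mf(x^2),\dots$. "Monotone increasing" on $[0,\epsilon]$ means $f(x)\le f(y)$ whenever $0\le x\le y\le\epsilon$. $\sqrt[r]{t}$ denotes $t^{1/r}$, with $r$ a positive real. An empty sum is $0$ (so $U_m=0$). *)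

theory Defs
  imports "HOL-Analysis.Analysis"
begin

text \<open>
  Sequences are indexed from 1 as in the mathematical text; the values at index 0 are never used,
  hence the shift by \<open>Suc\<close>. A sum is only admitted if the series converges, so no default value of
  a divergent series can enter; for a summable sequence of non-negative reals every choice of
  \<open>c\<close> contributes an element.
\<close>
definition achievement_set :: "(nat \<Rightarrow> real) \<Rightarrow> real set" where
  "achievement_set z =
     {s. \<exists>c :: nat \<Rightarrow> real. (\<forall>n\<ge>1. c n \<in> {0, 1}) \<and> (\<lambda>n. c (Suc n) * z (Suc n)) sums s}"

text \<open>The sequence $k_1 f(x), \dots, k_m f(x), k_1 f(x^2), \dots, k_m f(x^2), \dots$\<close>
definition multigeometric ::
    "(real \<Rightarrow> real) \<Rightarrow> nat \<Rightarrow> (nat \<Rightarrow> real) \<Rightarrow> real \<Rightarrow> nat \<Rightarrow> real" where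
  "multigeometric f m k x n = k (1 + (n - 1) mod m) * f (x ^ ((m + n - 1) div m))"

definition upper_sum :: "nat \<Rightarrow> (nat \<Rightarrow> real) \<Rightarrow> nat \<Rightarrow> real" where
  "upper_sum m k j = (\<Sum>i=j+1..m. k i)"

definition lower_sum :: "(nat \<Rightarrow> real) \<Rightarrow> nat \<Rightarrow> real" where
  "lower_sum k j = (\<Sum>i=1..j. k i)"

definition ratio_min :: "real \<Rightarrow> real \<Rightarrow> nat \<Rightarrow> (nat \<Rightarrow> real) \<Rightarrow> real" where
  "ratio_min a b m k =
     Min ((\<lambda>j. (a * k j - b * upper_sum m k j) / (a * k j + b * lower_sum k j)) ` {1..m})"

text \<open>
  The $r$-th root for real $r > 0$. It is meaningful only if \<^term>\<open>ratio_min a b m k\<close> is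
  non-negative: the value of \<^term>\<open>x powr s\<close> at a negative \<^term>\<open>x\<close> is a mere convention and need
  not be negative, so positivity has to be required of \<^const>\<open>ratio_min\<close> itself.
\<close>
definition d_C :: "real \<Rightarrow> real \<Rightarrow> real \<Rightarrow> nat \<Rightarrow> (nat \<Rightarrow> real) \<Rightarrow> real" where
  "d_C a b r m k = ratio_min a b m k powr (1 / r)"

primrec cantor_step :: "nat \<Rightarrow> real set" where
  "cantor_step 0 = {0..1}"
| "cantor_step (Suc n) =
     (\<lambda>t. t / 3) ` cantor_step n \<union> (\<lambda>t. 2 / 3 + t / 3) ` cantor_step n"

definition cantor_set :: "real set" where
  "cantor_set = (\<Inter>n. cantor_step n)"

end

theory Submission
  imports Defs
begin

text \<open>
  A series \<open>y\<close> of non-negative terms is called quickly convergent if every term exceeds the sum of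
  all later terms. Then a subsum determines the set of indices it is taken over: two index sets
  that first differ at \<open>n\<close> have subsums at distance at least \<open>y n - (\<Sum>i>n. y i) > 0\<close>. Conversely,
  index sets that agree below a large \<open>n\<close> have subsums that are close. Both facts together say
  that, for two quickly convergent series \<open>y\<close> and \<open>z\<close>, sending the subsum of \<open>y\<close> over \<open>A\<close> to the
  subsum of \<open>z\<close> over \<open>A\<close> is a homeomorphism between the two sets of subsums; it is the identity of
  \<open>{0, 1}\<^sup>\<nat>\<close> read in two coordinate systems, and the estimates replace any appeal to
  compactness of that space
  (\<open>continuous_on_transfer_subsum\<close>, \<open>homeomorphic_range_subsum\<close>).

  The Cantor set is the set of subsums of \<open>2/3, 2/9, 2/27, \<dots>\<close>, because of the ternary expansion
  (\<open>cantor_set_eq_range_subsum\<close>), so it remains to see that the multigeometric series is quickly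
  convergent. Put \<open>\<rho> = x\<^sup>r\<close>. The term \<open>k\<^sub>j f(x\<^sup>q)\<close> is at least \<open>a k\<^sub>j \<rho>\<^sup>q\<close>, and the terms after it
  are bounded by those of the series with \<open>b t\<^sup>r\<close> in place of \<open>f(t)\<close>, whose tail is
  \<open>b \<rho>\<^sup>q (U\<^sub>j + L\<^sub>m \<rho> / (1 - \<rho>))\<close>. Since \<open>L\<^sub>m = L\<^sub>j + U\<^sub>j\<close>, the inequality
  \<open>b (U\<^sub>j + L\<^sub>m \<rho> / (1 - \<rho>)) < a k\<^sub>j\<close> is equivalent to
  \<open>\<rho> < (a k\<^sub>j - b U\<^sub>j) / (a k\<^sub>j + b L\<^sub>j)\<close>, which for all \<open>j\<close> together is \<open>x < d\<^sub>C\<close>.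
\<close>

section \<open>Subsums of a non-negative series\<close>

text \<open>
  The choice sequence of zeros and ones is encoded as the set of indices at which it is one, so that
  an arbitrary element of the type is an admissible choice.
\<close>
definition subsum :: "(nat \<Rightarrow> real) \<Rightarrow> nat set \<Rightarrow> real" where
  "subsum y A = (\<Sum>n. indicat_real A n * y n)"

definition quickly_convergent :: "(nat \<Rightarrow> real) \<Rightarrow> bool" where
  "quickly_convergent y \<longleftrightarrow>
     summable y \<and> (\<forall>n. 0 \<le> y n) \<and> (\<forall>n. (\<Sum>i. y (i + Suc n)) < y n)"

lemma summable_indicator_mult:
  assumes "summable y" "\<And>n. 0 \<le> y n"
  shows "summable (\<lambda>n. indicat_real A n * y n)"
  by (rule summable_comparison_test'[OF assms(1), where N = 0])
     (use assms(2) in \<open>auto simp: indicator_def\<close>)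

lemma subsum_split:
  assumes "summable y" "\<And>n. 0 \<le> y n"
  shows "subsum y A = (\<Sum>i<n. indicat_real A i * y i) + (\<Sum>i. indicat_real A (i + n) * y (i + n))"
  unfolding subsum_def
  using suminf_split_initial_segment[OF summable_indicator_mult[OF assms], of A n] by simp

lemma subsum_tail_bounds:
  assumes "summable y" "\<And>n. 0 \<le> y n"
  shows "0 \<le> (\<Sum>i. indicat_real A (i + n) * y (i + n))"
    and "(\<Sum>i. indicat_real A (i + n) * y (i + n)) \<le> (\<Sum>i. y (i + n))"
proof -
  have sA: "summable (\<lambda>i. indicat_real A (i + n) * y (i + n))"
    using summable_ignore_initial_segment[OF summable_indicator_mult[OF assms]] .
  show "0 \<le> (\<Sum>i. indicat_real A (i + n) * y (i + n))"
    by (rule suminf_nonneg[OF sA]) (simp add: assms(2))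
  show "(\<Sum>i. indicat_real A (i + n) * y (i + n)) \<le> (\<Sum>i. y (i + n))"
    by (rule suminf_le[OF _ sA summable_ignore_initial_segment[OF assms(1)]])
       (use assms(2) in \<open>auto simp: indicator_def\<close>)
qed

lemma subsum_close:
  assumes "summable y" "\<And>n. 0 \<le> y n" and agree: "\<And>i. i < n \<Longrightarrow> i \<in> A \<longleftrightarrow> i \<in> B"
  shows "\<bar>subsum y A - subsum y B\<bar> \<le> (\<Sum>i. y (i + n))"
proof -
  have "(\<Sum>i<n. indicat_real A i * y i) = (\<Sum>i<n. indicat_real B i * y i)"
    by (rule sum.cong) (use agree in \<open>auto simp: indicator_def\<close>)
  then show ?thesis
    using subsum_split[OF assms(1,2), of A n] subsum_split[OF assms(1,2), of B n]
      subsum_tail_bounds[OF assms(1,2), of A n] subsum_tail_bounds[OF assms(1,2), of B n]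
    by linarith
qed

text \<open>
  In the worst case \<open>A\<close> has no element beyond \<open>n\<close> while \<open>B\<close> contains every index beyond \<open>n\<close>.
\<close>
lemma subsum_gap:
  assumes "summable y" "\<And>n. 0 \<le> y n"
    and agree: "\<And>i. i < n \<Longrightarrow> i \<in> A \<longleftrightarrow> i \<in> B" and n: "n \<in> A" "n \<notin> B"
  shows "y n - (\<Sum>i. y (i + Suc n)) \<le> subsum y A - subsum y B"
proof -
  have "(\<Sum>i<n. indicat_real A i * y i) = (\<Sum>i<n. indicat_real B i * y i)"
    by (rule sum.cong) (use agree in \<open>auto simp: indicator_def\<close>)
  then have "(\<Sum>i<Suc n. indicat_real A i * y i) = (\<Sum>i<Suc n. indicat_real B i * y i) + y n"
    using n by simp
  then show ?thesis
    using subsum_split[OF assms(1,2), of A "Suc n"] subsum_split[OF assms(1,2), of B "Suc n"]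
      subsum_tail_bounds[OF assms(1,2), of A "Suc n"] subsum_tail_bounds[OF assms(1,2), of B "Suc n"]
    by linarith
qed

lemma achievement_set_eq_range_subsum:
  assumes "summable (\<lambda>n. z (Suc n))" "\<And>n. 0 \<le> z (Suc n)"
  shows "achievement_set z = range (subsum (\<lambda>n. z (Suc n)))"
proof (intro equalityI subsetI)
  fix s assume "s \<in> achievement_set z"
  then obtain c where c: "\<forall>n\<ge>1. c n \<in> {0, 1}" and s: "(\<lambda>n. c (Suc n) * z (Suc n)) sums s"
    unfolding achievement_set_def by blast
  have "c (Suc n) = indicat_real {n. c (Suc n) = 1} n" for n
    using spec[OF c, of "Suc n"] by (auto simp: indicator_def)
  then have "(\<lambda>n. c (Suc n) * z (Suc n)) = (\<lambda>n. indicat_real {n. c (Suc n) = 1} n * z (Suc n))"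
    by metis
  then have "s = subsum (\<lambda>n. z (Suc n)) {n. c (Suc n) = 1}"
    using s unfolding subsum_def by (simp add: sums_iff)
  then show "s \<in> range (subsum (\<lambda>n. z (Suc n)))" by blast
next
  fix s assume "s \<in> range (subsum (\<lambda>n. z (Suc n)))"
  then obtain A where "s = subsum (\<lambda>n. z (Suc n)) A" by blast
  then have "(\<lambda>n. indicat_real A n * z (Suc n)) sums s"
    using summable_indicator_mult[OF assms] unfolding subsum_def by (simp add: summable_sums)
  then show "s \<in> achievement_set z"
    unfolding achievement_set_def
    by (intro CollectI exI[of _ "\<lambda>n. indicat_real A (n - 1)"]) (auto simp: indicator_def)
qed

section \<open>Quickly convergent series have homeomorphic sets of subsums\<close>

text \<open>Subsums that are closer than the finitely many gaps at \<open>i < n\<close> share their first \<open>n\<close> digits.\<close>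
lemma quickly_convergent_separates:
  assumes "quickly_convergent y"
  obtains \<delta> where "\<delta> > 0"
    and "\<And>A B i. \<bar>subsum y A - subsum y B\<bar> < \<delta> \<Longrightarrow> i < n \<Longrightarrow> i \<in> A \<longleftrightarrow> i \<in> B"
proof -
  have y: "summable y" "\<And>n. 0 \<le> y n" and gap: "\<And>n. (\<Sum>i. y (i + Suc n)) < y n"
    using assms unfolding quickly_convergent_def by auto
  \<comment> \<open>The entry \<open>1\<close> keeps the set non-empty when \<open>n = 0\<close>.\<close>
  define \<delta> where "\<delta> = Min (insert 1 ((\<lambda>i. y i - (\<Sum>j. y (j + Suc i))) ` {..<n}))"
  have pos: "\<delta> > 0"
    unfolding \<delta>_def using gap by (subst Min_gr_iff) (auto simp del: add_Suc_right)
  have le: "\<delta> \<le> y i - (\<Sum>j. y (j + Suc i))" if "i < n" for i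
    unfolding \<delta>_def by (rule Min_le) (use that in auto)
  have "i \<in> A \<longleftrightarrow> i \<in> B" if close: "\<bar>subsum y A - subsum y B\<bar> < \<delta>" and i: "i < n" for A B i
  proof (rule ccontr)
    assume diff: "\<not> (i \<in> A \<longleftrightarrow> i \<in> B)"
    define j where "j = (LEAST i. \<not> (i \<in> A \<longleftrightarrow> i \<in> B))"
    have j: "\<not> (j \<in> A \<longleftrightarrow> j \<in> B)"
      unfolding j_def using diff by (rule LeastI[where P = "\<lambda>i. \<not> (i \<in> A \<longleftrightarrow> i \<in> B)"])
    have agree: "\<And>l. l < j \<Longrightarrow> l \<in> A \<longleftrightarrow> l \<in> B"
      unfolding j_def using not_less_Least by blast
    have "j \<le> i"
      unfolding j_def using diff by (rule Least_le[where P = "\<lambda>i. \<not> (i \<in> A \<longleftrightarrow> i \<in> B)"])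
    have "y j - (\<Sum>i. y (i + Suc j)) \<le> \<bar>subsum y A - subsum y B\<bar>"
    proof (cases "j \<in> A")
      case True
      then show ?thesis using subsum_gap[OF y, of j A B] agree j by fastforce
    next
      case False
      then show ?thesis using subsum_gap[OF y, of j B A] agree j by fastforce
    qed
    then show False using le[of j] close \<open>j \<le> i\<close> i by linarith
  qed
  with pos show thesis by (rule that)
qed

lemma inj_subsum:
  assumes "quickly_convergent y"
  shows "inj (subsum y)"
proof (rule injI)
  fix A B assume eq: "subsum y A = subsum y B"
  have "i \<in> A \<longleftrightarrow> i \<in> B" for i
    by (rule quickly_convergent_separates[OF assms, of "Suc i"]) (use eq in auto)
  then show "A = B" by blast
qed

lemma continuous_on_transfer_subsum:
  assumes "quickly_convergent y" and z: "summable z" "\<And>n. 0 \<le> z n"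
  shows "continuous_on (range (subsum y)) (subsum z \<circ> inv (subsum y))"
  unfolding continuous_on_iff
proof (intro ballI allI impI)
  fix s e :: real assume "s \<in> range (subsum y)" and e: "e > 0"
  then obtain A where s: "s = subsum y A" by blast
  obtain n where n: "norm (\<Sum>i. z (i + n)) < e"
    using suminf_exist_split[OF e z(1)] by blast
  obtain \<delta> where \<delta>: "\<delta> > 0"
    "\<And>A B i. \<bar>subsum y A - subsum y B\<bar> < \<delta> \<Longrightarrow> i < n \<Longrightarrow> i \<in> A \<longleftrightarrow> i \<in> B"
    by (rule quickly_convergent_separates[OF assms(1), of n]) (use that in blast)
  have "dist ((subsum z \<circ> inv (subsum y)) t) ((subsum z \<circ> inv (subsum y)) s) < e"
    if "t \<in> range (subsum y)" and d: "dist t s < \<delta>" for t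
  proof -
    obtain B where t: "t = subsum y B" using \<open>t \<in> range (subsum y)\<close> by blast
    have "\<bar>subsum z B - subsum z A\<bar> \<le> (\<Sum>i. z (i + n))"
      by (rule subsum_close[OF z]) (use \<delta>(2) d in \<open>auto simp: s t dist_real_def\<close>)
    then show ?thesis
      using n by (simp add: s t inv_f_f[OF inj_subsum[OF assms(1)]] dist_real_def)
  qed
  with \<delta>(1) show "\<exists>d>0. \<forall>t\<in>range (subsum y). dist t s < d \<longrightarrow>
      dist ((subsum z \<circ> inv (subsum y)) t) ((subsum z \<circ> inv (subsum y)) s) < e"
    by blast
qed

lemma homeomorphic_range_subsum:
  assumes y: "quickly_convergent y" and z: "quickly_convergent z"
  shows "range (subsum y) homeomorphic range (subsum z)"
proof -
  have "homeomorphism (range (subsum y)) (range (subsum z))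
          (subsum z \<circ> inv (subsum y)) (subsum y \<circ> inv (subsum z))"
    by (intro homeomorphismI continuous_on_transfer_subsum assms)
       (use y z in \<open>auto simp: quickly_convergent_def
                       inv_f_f[OF inj_subsum[OF y]] inv_f_f[OF inj_subsum[OF z]]\<close>)
  then show ?thesis unfolding homeomorphic_def by blast
qed

text \<open>
  A majorant \<open>R n\<close> of the tail after \<open>n\<close> need only be verified one step at a time, so that no tail of
  \<open>y\<close> has to be evaluated.
\<close>
lemma quickly_convergentI:
  assumes nonneg: "\<And>n. 0 \<le> y n" and lim: "R \<longlonglongrightarrow> 0"
    and step: "\<And>n. y (Suc n) \<le> R n - R (Suc n)" and less: "\<And>n. R n < y n"
  shows "quickly_convergent y"
proof -
  have tel: "(\<lambda>i. R (i + n) - R (Suc i + n)) sums R n" for n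
    using telescope_sums'[OF LIMSEQ_ignore_initial_segment[OF lim, of n]] by simp
  have "summable (\<lambda>n. y (Suc n))"
    by (rule summable_comparison_test'[OF sums_summable[OF tel[of 0]], where N = 0])
       (use nonneg step in auto)
  then have summ: "summable y" by (simp only: summable_Suc_iff)
  have "(\<Sum>i. y (i + Suc n)) < y n" for n
  proof -
    have "(\<Sum>i. y (i + Suc n)) \<le> (\<Sum>i. R (i + n) - R (Suc i + n))"
      by (rule suminf_le[OF _ summable_ignore_initial_segment[OF summ] sums_summable[OF tel]])
         (use step in auto)
    also have "\<dots> = R n" using tel[of n] by (simp add: sums_iff)
    finally show ?thesis using less[of n] by linarith
  qed
  with summ nonneg show ?thesis unfolding quickly_convergent_def by blast
qed

section \<open>The Cantor set as a set of subsums\<close>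

lemma quickly_convergent_ternary: "quickly_convergent (\<lambda>n. 2 / 3 ^ Suc n)"
proof (rule quickly_convergentI[where R = "\<lambda>n. 1 / 3 ^ Suc n"])
  have "(\<lambda>n. (1/3 :: real) ^ Suc n) \<longlonglongrightarrow> 0"
    by (rule LIMSEQ_Suc, rule LIMSEQ_realpow_zero) auto
  then show "(\<lambda>n. 1 / 3 ^ Suc n :: real) \<longlonglongrightarrow> 0"
    by (simp only: power_one_over)
qed (auto simp: field_simps)

lemma cantor_step_subset_unit: "cantor_step n \<subseteq> {0..1}"
  by (induction n) auto

text \<open>Splitting off the first ternary digit.\<close>
lemma subsum_ternary_shift:
  "subsum (\<lambda>n. 2 / 3 ^ Suc n) A =
     2 / 3 * indicat_real A 0 + subsum (\<lambda>n. 2 / 3 ^ Suc n) {n. Suc n \<in> A} / 3"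
proof -
  let ?y = "\<lambda>n. 2 / 3 ^ Suc n :: real"
  have y: "summable ?y" "\<And>n. 0 \<le> ?y n"
    using quickly_convergent_ternary unfolding quickly_convergent_def by auto
  have "(\<Sum>i. indicat_real A (i + 1) * ?y (i + 1))
      = (\<Sum>i. indicat_real {n. Suc n \<in> A} i * ?y i / 3)"
    by (intro suminf_cong) (auto simp: indicator_def)
  also have "\<dots> = subsum ?y {n. Suc n \<in> A} / 3"
    unfolding subsum_def by (rule suminf_divide[OF summable_indicator_mult[OF y]])
  finally show ?thesis
    using subsum_split[OF y, of A 1] by simp
qed

lemma subsum_ternary_in_cantor_step: "subsum (\<lambda>n. 2 / 3 ^ Suc n) A \<in> cantor_step n"
proof (induction n arbitrary: A)
  case 0
  let ?y = "\<lambda>n. 2 / 3 ^ Suc n :: real"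
  have y: "summable ?y" "\<And>n. 0 \<le> ?y n"
    using quickly_convergent_ternary unfolding quickly_convergent_def by auto
  have "?y = (\<lambda>n. 2 / 3 * (1 / 3) ^ n)"
    by (auto simp: power_one_over)
  then have "suminf ?y = 1"
    using geometric_sums[of "1/3 :: real", THEN sums_mult, of "2/3"] by (simp add: sums_iff)
  then show ?case
    using subsum_split[OF y, of A 0] subsum_tail_bounds[OF y, of A 0] by simp
next
  case (Suc n)
  show ?case
    using Suc.IH[of "{n. Suc n \<in> A}"] by (subst subsum_ternary_shift) (auto simp: indicator_def)
qed

text \<open>
  The digit-removing map on the Cantor set: it inverts \<open>t \<mapsto> t/3\<close> on the left third and
  \<open>t \<mapsto> 2/3 + t/3\<close> on the right third, and thus carries a point to the one whose ternary
  expansion lacks the leading digit.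
\<close>
definition ternary_shift :: "real \<Rightarrow> real" where
  "ternary_shift s = (if s > 1/2 then 3 * s - 2 else 3 * s)"

lemma ternary_shift_cantor_set:
  assumes "s \<in> cantor_set"
  shows "ternary_shift s \<in> cantor_set"
proof -
  have "ternary_shift s \<in> cantor_step n" for n
  proof -
    have "s \<in> cantor_step (Suc n)" using assms unfolding cantor_set_def by blast
    then obtain t where t: "t \<in> cantor_step n" and s: "s = t / 3 \<or> s = 2 / 3 + t / 3"
      by auto
    from t have "t \<in> {0..1}" using cantor_step_subset_unit by blast
    with s have "ternary_shift s = t" by (auto simp: ternary_shift_def)
    with t show ?thesis by simp
  qed
  then show ?thesis unfolding cantor_set_def by blast
qed

lemma cantor_set_eq_range_subsum: "cantor_set = range (subsum (\<lambda>n. 2 / 3 ^ Suc n))"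
proof (intro equalityI subsetI)
  fix s assume s: "s \<in> cantor_set"
  define T where "T n = (ternary_shift ^^ n) s" for n
  define A where "A = {n. T n > 1/2}"
  have "T n \<in> cantor_set" for n
    by (induction n) (use s ternary_shift_cantor_set in \<open>auto simp: T_def\<close>)
  then have "T n \<in> cantor_step 0" for n
    unfolding cantor_set_def by blast
  then have T01: "0 \<le> T n \<and> T n \<le> 1" for n
    by simp
  have digit: "indicat_real A n * (2 / 3 ^ Suc n) = T n / 3 ^ n - T (Suc n) / 3 ^ Suc n" for n
    by (auto simp: A_def T_def ternary_shift_def indicator_def field_simps)
  have "(\<lambda>n. T n / 3 ^ n) \<longlonglongrightarrow> 0"
  proof (rule real_tendsto_sandwich[where f = "\<lambda>_. 0" and h = "\<lambda>n. (1/3) ^ n"])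
    show "(\<lambda>n. (1/3 :: real) ^ n) \<longlonglongrightarrow> 0" by (rule LIMSEQ_realpow_zero) auto
  qed (use T01 in \<open>auto simp: power_one_over field_simps\<close>)
  then have "(\<lambda>n. indicat_real A n * (2 / 3 ^ Suc n)) sums s"
    unfolding digit using telescope_sums'[of "\<lambda>n. T n / 3 ^ n" 0] by (simp add: T_def)
  then have "s = subsum (\<lambda>n. 2 / 3 ^ Suc n) A"
    unfolding subsum_def by (simp add: sums_iff)
  then show "s \<in> range (subsum (\<lambda>n. 2 / 3 ^ Suc n))" by blast
next
  fix s assume "s \<in> range (subsum (\<lambda>n. 2 / 3 ^ Suc n))"
  then show "s \<in> cantor_set"
    unfolding cantor_set_def using subsum_ternary_in_cantor_step by blast
qed

section \<open>Multigeometric series\<close>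

lemma upper_sum_rec: "j < m \<Longrightarrow> upper_sum m k j = k (Suc j) + upper_sum m k (Suc j)"
  unfolding upper_sum_def by (simp add: sum.atLeast_Suc_atMost)

lemma lower_sum_plus_upper_sum: "j \<le> m \<Longrightarrow> lower_sum k j + upper_sum m k j = lower_sum k m"
  unfolding upper_sum_def lower_sum_def
  using sum.ub_add_nat[of 1 j k "m - j"] by simp

text \<open>
  The tail of the sequence with \<open>b t\<^sup>r\<close> in place of \<open>f(t)\<close>: after the index \<open>p\<close>, counted from zero,
  there follow the rest of the block of \<open>p\<close> and all later blocks.
\<close>
definition block_tail :: "real \<Rightarrow> real \<Rightarrow> nat \<Rightarrow> (nat \<Rightarrow> real) \<Rightarrow> nat \<Rightarrow> real" where
  "block_tail b \<rho> m k p =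
     b * \<rho> ^ Suc (p div m) * (upper_sum m k (Suc (p mod m)) + lower_sum k m * \<rho> / (1 - \<rho>))"

lemma block_tail_step:
  assumes "1 \<le> m" "0 < \<rho>" "\<rho> < 1"
  shows "block_tail b \<rho> m k p - block_tail b \<rho> m k (Suc p) =
    b * k (Suc (Suc p mod m)) * \<rho> ^ Suc (Suc p div m)"
proof (cases "Suc (p mod m) = m")
  case True
  \<comment> \<open>Here \<open>p\<close> is the last index of its block.\<close>
  have "upper_sum m k (Suc 0) = lower_sum k m - k 1"
    using lower_sum_plus_upper_sum[OF assms(1), of k] by (simp add: lower_sum_def)
  moreover have "upper_sum m k m = 0" by (simp add: upper_sum_def)
  moreover have "Suc p mod m = 0" "Suc p div m = Suc (p div m)"
    using True by (auto simp: mod_Suc div_Suc)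
  moreover have "b * \<rho> ^ Suc d * (0 + l * \<rho> / (1 - \<rho>))
      - b * \<rho> ^ Suc (Suc d) * (l - k1 + l * \<rho> / (1 - \<rho>)) = b * k1 * \<rho> ^ Suc (Suc d)" for d l k1
  proof -
    define t where "t = l * \<rho> / (1 - \<rho>)"
    have t: "t = \<rho> * (l + t)" using assms(3) by (simp add: t_def field_simps)
    have "b * \<rho> ^ Suc d * (0 + t) - b * \<rho> ^ Suc (Suc d) * (l - k1 + t)
        = b * \<rho> ^ Suc d * (t - \<rho> * (l + t)) + b * k1 * \<rho> ^ Suc (Suc d)"
      by (simp add: algebra_simps)
    with t show ?thesis by (simp flip: t_def)
  qed
  ultimately show ?thesis using True by (simp add: block_tail_def)
next
  case False
  have "p mod m < m" using assms(1) by simp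
  then have "upper_sum m k (Suc (p mod m)) =
      k (Suc (Suc (p mod m))) + upper_sum m k (Suc (Suc (p mod m)))"
    using False by (intro upper_sum_rec) simp
  moreover have "Suc p mod m = Suc (p mod m)" "Suc p div m = p div m"
    using False by (auto simp: mod_Suc div_Suc)
  ultimately show ?thesis by (simp add: block_tail_def algebra_simps)
qed

lemma block_tail_tendsto_0:
  assumes "1 \<le> m" "0 < \<rho>" "\<rho> < 1"
  shows "block_tail b \<rho> m k \<longlonglongrightarrow> 0"
proof -
  have "filterlim (\<lambda>p. p div m) at_top sequentially"
    unfolding filterlim_at_top
  proof
    fix N
    show "eventually (\<lambda>p. N \<le> p div m) sequentially"
      using eventually_ge_at_top[of "N * m"]
      by eventually_elim (use assms(1) in \<open>simp add: less_eq_div_iff_mult_less_eq\<close>)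
  qed
  moreover have "(\<lambda>q. \<rho> ^ q) \<longlonglongrightarrow> 0"
    using assms by (intro LIMSEQ_realpow_zero) auto
  ultimately have lim: "(\<lambda>p. \<rho> ^ (p div m)) \<longlonglongrightarrow> 0"
    by (rule filterlim_compose[rotated])
  define c where
    "c p = b * \<rho> * (upper_sum m k (Suc (p mod m)) + lower_sum k m * \<rho> / (1 - \<rho>))" for p
  \<comment> \<open>The remaining factor depends on the residue of \<open>p\<close> only and is therefore bounded.\<close>
  have "range c \<subseteq> c ` {..<m}"
  proof
    fix v assume "v \<in> range c"
    then obtain p where "v = c p" by blast
    then have "v = c (p mod m)" by (simp add: c_def)
    then show "v \<in> c ` {..<m}" using assms(1) by simp
  qed
  then have "bounded (range c)"
    by (rule bounded_subset[rotated]) (simp add: finite_imp_bounded)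
  then obtain K where K: "\<And>p. norm (c p) \<le> K"
    unfolding bounded_iff by blast
  have "(\<lambda>p. c p * \<rho> ^ (p div m)) \<longlonglongrightarrow> 0"
    by (rule tendsto_0_le[OF lim, where K = K])
       (rule eventuallyI, simp only: norm_mult mult.commute[of _ K], rule mult_right_mono[OF K norm_ge_zero])
  moreover have "c p * \<rho> ^ (p div m) = block_tail b \<rho> m k p" for p
    by (simp add: c_def block_tail_def)
  ultimately show ?thesis by simp
qed

text \<open>
  Since \<open>1 - \<rho> > 0\<close> and \<open>L\<^sub>m = L\<^sub>j + U\<^sub>j\<close>, clearing the denominator and collecting the terms with
  \<open>\<rho>\<close> turns the conclusion into \<open>\<rho> (a k\<^sub>j + b L\<^sub>j) < a k\<^sub>j - b U\<^sub>j\<close>.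
\<close>
lemma ratio_min_tail_less:
  assumes "0 < a" "0 < b" and j: "j \<in> {1..m}" and kpos: "\<And>i. i \<in> {1..m} \<Longrightarrow> 0 < k i"
    and "\<rho> < ratio_min a b m k" "\<rho> < 1"
  shows "b * (upper_sum m k j + lower_sum k m * \<rho> / (1 - \<rho>)) < a * k j"
proof -
  have "0 \<le> lower_sum k j"
    unfolding lower_sum_def by (rule sum_nonneg) (use kpos j in \<open>force intro: less_imp_le\<close>)
  then have den: "0 < a * k j + b * lower_sum k j"
    using assms(1,2) kpos[OF j] by (simp add: add_pos_nonneg)
  have "ratio_min a b m k \<le> (a * k j - b * upper_sum m k j) / (a * k j + b * lower_sum k j)"
    unfolding ratio_min_def by (rule Min_le) (use j in auto)
  then have "\<rho> < (a * k j - b * upper_sum m k j) / (a * k j + b * lower_sum k j)"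
    using assms(5) by linarith
  then have "\<rho> * (a * k j + b * lower_sum k j) < a * k j - b * upper_sum m k j"
    using den by (simp add: pos_less_divide_eq)
  moreover have "lower_sum k m = lower_sum k j + upper_sum m k j"
    using lower_sum_plus_upper_sum[of j m k] j by simp
  ultimately show ?thesis
    using assms(6) by (simp add: field_simps)
qed

theorem theorem2p14:
  fixes f :: "real \<Rightarrow> real" and \<epsilon> a b r x :: real
    and m :: nat and k :: "nat \<Rightarrow> real"
  assumes "0 < \<epsilon>" and "\<epsilon> < 1"
    and "0 < a" and "0 < b" and "0 < r"
    and "mono_on {0..\<epsilon>} f"
    and "\<And>y. y \<in> {0..\<epsilon>} \<Longrightarrow> a * y powr r \<le> f y \<and> f y \<le> b * y powr r"
    and "1 \<le> m"
    and "antimono_on {1..m} k" and "0 < k m"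
    and "0 < ratio_min a b m k"
    and "0 < x" and "x < min \<epsilon> (d_C a b r m k)"
  shows "achievement_set (multigeometric f m k x) homeomorphic cantor_set"
proof -
  define \<rho> where "\<rho> = x powr r"
  define y where "y p = multigeometric f m k x (Suc p)" for p
  have x1: "x < 1" and xe: "x < \<epsilon>" and xd: "x < d_C a b r m k" using assms(2,13) by auto
  have \<rho>0: "0 < \<rho>" using \<open>0 < x\<close> by (simp add: \<rho>_def)
  have "\<rho> < 1 powr r"
    unfolding \<rho>_def using x1 \<open>0 < x\<close> \<open>0 < r\<close> by (intro powr_less_mono2) auto
  then have \<rho>1: "\<rho> < 1" by simp
  have "\<rho> < (ratio_min a b m k powr (1 / r)) powr r"
    unfolding \<rho>_def using xd \<open>0 < x\<close> \<open>0 < r\<close> unfolding d_C_def by (intro powr_less_mono2) auto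
  then have \<rho>M: "\<rho> < ratio_min a b m k"
    using \<open>0 < r\<close> \<open>0 < ratio_min a b m k\<close> by (simp add: powr_powr)
  have kpos: "0 < k i" if "i \<in> {1..m}" for i
    using monotone_onD[OF assms(9) that, of m] that \<open>0 < k m\<close> \<open>1 \<le> m\<close> by simp
  have bounds: "a * \<rho> ^ Suc q \<le> f (x ^ Suc q)" "f (x ^ Suc q) \<le> b * \<rho> ^ Suc q" for q
  proof -
    have "x ^ Suc q \<le> x ^ 1" using \<open>0 < x\<close> x1 by (intro power_decreasing) auto
    then have "x ^ Suc q \<in> {0..\<epsilon>}" using xe \<open>0 < x\<close> by (simp del: power_Suc)
    moreover have "(x ^ Suc q) powr r = \<rho> ^ Suc q"
      unfolding \<rho>_def using \<open>0 < x\<close>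
      by (simp add: powr_realpow[symmetric] powr_powr mult.commute del: power_Suc)
    ultimately show "a * \<rho> ^ Suc q \<le> f (x ^ Suc q)" "f (x ^ Suc q) \<le> b * \<rho> ^ Suc q"
      using assms(7) by metis+
  qed
  have y_eq: "y p = k (Suc (p mod m)) * f (x ^ Suc (p div m))" for p
    using \<open>1 \<le> m\<close> by (simp add: y_def multigeometric_def)
  have res: "Suc (p mod m) \<in> {1..m}" for p
    using \<open>1 \<le> m\<close> by (simp add: Suc_le_eq)
  have lower: "a * k (Suc (p mod m)) * \<rho> ^ Suc (p div m) \<le> y p" for p
    unfolding y_eq using mult_left_mono[OF bounds(1) less_imp_le[OF kpos[OF res]]]
    by (metis mult.assoc mult.commute)
  have upper: "y p \<le> b * k (Suc (p mod m)) * \<rho> ^ Suc (p div m)" for p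
    unfolding y_eq using mult_left_mono[OF bounds(2) less_imp_le[OF kpos[OF res]]]
    by (metis mult.assoc mult.commute)
  have quick: "quickly_convergent y"
  proof (rule quickly_convergentI)
    show "0 \<le> y p" for p
      using lower[of p] \<open>0 < a\<close> \<rho>0 kpos[OF res[of p]]
      by (meson less_imp_le mult_pos_pos order_trans zero_less_power)
    show "block_tail b \<rho> m k \<longlonglongrightarrow> 0"
      by (rule block_tail_tendsto_0[OF \<open>1 \<le> m\<close> \<rho>0 \<rho>1])
    show "y (Suc p) \<le> block_tail b \<rho> m k p - block_tail b \<rho> m k (Suc p)" for p
      unfolding block_tail_step[OF \<open>1 \<le> m\<close> \<rho>0 \<rho>1] by (rule upper)
    show "block_tail b \<rho> m k p < y p" for p
    proof -
      have "block_tail b \<rho> m k p < a * k (Suc (p mod m)) * \<rho> ^ Suc (p div m)"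
        using mult_strict_right_mono[OF
            ratio_min_tail_less[OF \<open>0 < a\<close> \<open>0 < b\<close> res[of p] kpos \<rho>M \<rho>1]
            zero_less_power[OF \<rho>0, of "Suc (p div m)"]]
        by (simp add: block_tail_def mult_ac)
      then show ?thesis using lower[of p] by linarith
    qed
  qed
  then have "achievement_set (multigeometric f m k x) = range (subsum y)"
    using achievement_set_eq_range_subsum[of "multigeometric f m k x"]
    by (simp add: quickly_convergent_def y_def[symmetric, abs_def])
  then show ?thesis
    using homeomorphic_range_subsum[OF quick quickly_convergent_ternary]
    by (simp only: cantor_set_eq_range_subsum)
qed

end
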